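(* Let $A\in\mathbb{C}\setminus\{0\}$, let $$M=\begin{pmatrix}0& iA\\ -iA^{-1}&0\end{pmatrix},\qquad M^{ab}=M_{ab}\ \text{ the entries of } M,$$ and let $R$ be the bracket solution of the Yang-Baxter equation on $\mathbb{C}^2\otimes\mathbb{C}^2$, $$R^{ab}_{cd}=A\,M^{ab}M_{cd}+A^{-1}\delta^a_c\delta^b_d,\qquad\text{i.e.}\qquad R=\begin{pmatrix}A^{-1}&0&0&0\\0&A^{-1}-A^3&A&0\\0&A&0&0\\0&0&0&A^{-1}\end{pmatrix}$$ in the ordered basis $|00\rangle,|01\rangle,|10\rangle,|11\rangle$. If $R$ is unitary, then $R$ is not entangling.
   Context: Let $V=\mathbb{C}^2$ with orthonormal basis $|0\rangle,|1\rangle$. A unitary map $R:V\otimes V\to V\otimes V$ is entangling if there are $|\alpha\rangle,|\beta\rangle\in V$ such that $R(|\alpha\rangle\otimes|\beta\rangle)$ is not of the form $|\alpha'\rangle\otimes|\beta'\rangle$ with $|\alpha'\rangle,|\beta'\rangle\in V$. *)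

theory Defs
  imports "HOL-Analysis.Analysis"
begin

text \<open>
  The index type \<^typ>\<open>2\<close> has exactly the elements 0 and 1, so \<^typ>\<open>complex ^ 2\<close> is the one-qubit
  space, with \<open>|0\<rangle> = axis 0 1\<close> and \<open>|1\<rangle> = axis 1 1\<close>. Its tensor square is
  \<^typ>\<open>complex ^ (2 \<times> 2)\<close>, with \<open>|ab\<rangle> = axis (a, b) 1\<close>. A linear map is identified with its matrix
  in this orthonormal basis and acts by \<open>*v\<close>.
\<close>

definition tensor_vec :: "complex ^ 'm \<Rightarrow> complex ^ 'n \<Rightarrow> complex ^ ('m \<times> 'n)" where
  "tensor_vec \<alpha> \<beta> = (\<chi> p. \<alpha> $ fst p * \<beta> $ snd p)"

definition conj_transpose :: "complex ^ 'n ^ 'm \<Rightarrow> complex ^ 'm ^ 'n" where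
  "conj_transpose U = (\<chi> i j. cnj (U $ j $ i))"

definition unitary_matrix :: "complex ^ 'n ^ 'n \<Rightarrow> bool" where
  "unitary_matrix U \<longleftrightarrow> conj_transpose U ** U = mat 1 \<and> U ** conj_transpose U = mat 1"

definition entangling :: "complex ^ (2 \<times> 2) ^ (2 \<times> 2) \<Rightarrow> bool" where
  "entangling R \<longleftrightarrow>
     (\<exists>\<alpha> \<beta>. \<not> (\<exists>\<alpha>' \<beta>'. R *v tensor_vec \<alpha> \<beta> = tensor_vec \<alpha>' \<beta>'))"

definition bracket_M :: "complex \<Rightarrow> complex ^ 2 ^ 2" where
  "bracket_M A = (\<chi> a b. if a = 0 \<and> b = 1 then \<i> * A
                         else if a = 1 \<and> b = 0 then - \<i> * inverse A
                         else 0)"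

text \<open>
  The row index is the upper pair \<open>(a, b)\<close> and the column index the lower pair \<open>(c, d)\<close>; the
  opposite convention yields the same matrix, which is symmetric.
\<close>

definition bracket_R :: "complex \<Rightarrow> complex ^ (2 \<times> 2) ^ (2 \<times> 2)" where
  "bracket_R A = (\<chi> p q. case (p, q) of ((a, b), (c, d)) \<Rightarrow>
     A * bracket_M A $ a $ b * bracket_M A $ c $ d
       + inverse A * of_bool (a = c) * of_bool (b = d))"

lemma bracket_R_entries:
  assumes "A \<noteq> 0"
  shows
    "bracket_R A $ (0,0) $ (0,0) = inverse A" "bracket_R A $ (0,0) $ (0,1) = 0"
    "bracket_R A $ (0,0) $ (1,0) = 0" "bracket_R A $ (0,0) $ (1,1) = 0"
    "bracket_R A $ (0,1) $ (0,0) = 0" "bracket_R A $ (0,1) $ (0,1) = inverse A - A ^ 3"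
    "bracket_R A $ (0,1) $ (1,0) = A" "bracket_R A $ (0,1) $ (1,1) = 0"
    "bracket_R A $ (1,0) $ (0,0) = 0" "bracket_R A $ (1,0) $ (0,1) = A"
    "bracket_R A $ (1,0) $ (1,0) = 0" "bracket_R A $ (1,0) $ (1,1) = 0"
    "bracket_R A $ (1,1) $ (0,0) = 0" "bracket_R A $ (1,1) $ (0,1) = 0"
    "bracket_R A $ (1,1) $ (1,0) = 0" "bracket_R A $ (1,1) $ (1,1) = inverse A"
  using assms by (simp_all add: bracket_R_def bracket_M_def field_simps power3_eq_cube)

end

theory Submission
  imports Defs
begin

text \<open>
  Orthogonality of the columns \<open>|01\<rangle>\<close> and \<open>|10\<rangle>\<close> of a unitary \<open>R\<close> forces the one entry that keeps
  \<open>R\<close> from being a weighted swap, \<open>A\<^sup>-\<^sup>1 - A\<^sup>3\<close>, to vanish, so \<open>A ^ 4 = 1\<close>. What remains is the swap of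
  the two factors followed by the phases \<open>A\<^sup>-\<^sup>1, A, A, A\<^sup>-\<^sup>1\<close>. Since \<open>A ^ 4 = 1\<close>, these phases are those
  of the local map \<open>diag(1, A\<^sup>2) \<otimes> diag(A\<^sup>-\<^sup>1, A)\<close>, and both the swap and a local map send product
  vectors to product vectors.
\<close>

lemma UNIV_2_zero_one: "(UNIV :: 2 set) = {0, 1}"
proof -
  have "(2 :: 2) = 0" by simp
  then show ?thesis using UNIV_2 by auto
qed

lemma forall_2_zero_one: "(\<forall>i :: 2. P i) \<longleftrightarrow> P 0 \<and> P 1"
  using UNIV_2_zero_one by (metis UNIV_I insert_iff singletonD)

lemma sum_2_times_2:
  "(\<Sum>p\<in>(UNIV :: (2 \<times> 2) set). f p) = f (0,0) + f (0,1) + f (1,0) + f (1,1)"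
proof -
  have "(\<Sum>p\<in>(UNIV :: (2 \<times> 2) set). f p) = (\<Sum>a\<in>UNIV. \<Sum>b\<in>UNIV. f (a, b))"
    by (simp add: sum.cartesian_product flip: UNIV_Times_UNIV)
  then show ?thesis
    by (simp add: UNIV_2_zero_one add.assoc)
qed

text \<open>
  Column \<open>|10\<rangle>\<close> of \<open>R\<close> is \<open>A |01\<rangle>\<close>, so its inner product with column \<open>|01\<rangle>\<close> sees only the
  diagonal entry \<open>A\<^sup>-\<^sup>1 - A\<^sup>3\<close>.
\<close>
lemma unitary_bracket_R_imp_fourth_root:
  assumes "A \<noteq> 0" and "unitary_matrix (bracket_R A)"
  shows "A ^ 4 = 1"
proof -
  have "(conj_transpose (bracket_R A) ** bracket_R A) $ (0,1) $ (1,0) = 0"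
    using assms(2) by (simp add: unitary_matrix_def mat_def)
  then have "cnj (inverse A - A ^ 3) * A = 0"
    unfolding matrix_matrix_mult_def conj_transpose_def
    by (simp add: sum_2_times_2 bracket_R_entries[OF assms(1)])
  then have "inverse A - A ^ 3 = 0"
    using assms(1) by (metis complex_cnj_zero_iff mult_eq_0_iff)
  then show ?thesis
    using assms(1) by (simp add: field_simps eval_nat_numeral)
qed

lemma bracket_R_tensor_vec:
  assumes "A \<noteq> 0" and "A ^ 4 = 1"
  shows "bracket_R A *v tensor_vec \<alpha> \<beta> =
    tensor_vec (\<chi> i. (if i = 0 then 1 else A ^ 2) * \<beta> $ i)
               (\<chi> i. (if i = 0 then inverse A else A) * \<alpha> $ i)"
proof -
  have inv: "inverse A = A ^ 3"
    using assms by (simp add: field_simps eval_nat_numeral)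
  have pow: "A ^ 2 * A ^ 3 = A"
    using assms(2) by (simp add: eval_nat_numeral)
  show ?thesis
    unfolding vec_eq_iff split_paired_All forall_2_zero_one
    using pow
    by (simp add: matrix_vector_mult_def sum_2_times_2 bracket_R_entries[OF assms(1)]
        tensor_vec_def inv)
       (simp add: eval_nat_numeral mult_ac)
qed

theorem mainTheorem6:
  fixes A :: complex
  assumes "A \<noteq> 0"
    and "unitary_matrix (bracket_R A)"
  shows "\<not> entangling (bracket_R A)"
  using bracket_R_tensor_vec[OF assms(1) unitary_bracket_R_imp_fourth_root[OF assms]]
  unfolding entangling_def by blast

end
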